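(* Let $\mathcal{M}=\mathcal{M}(\Sigma,I)$ be a trace monoid acting partially on a finite set $X_0$ of states, with associated total action on $X=X_0\cup\{\bot\}$. Then in the $\mathbb{Z}$-algebra of fibred formal series indexed by $X_0$, the Möbius fibred polynomial $\mu$ is the inverse of the zeta fibred formal series $\zeta$: $\mu\zeta=\zeta\mu=I$.
   Context: Trace monoid: $\Sigma$ finite, $|\Sigma|\ge2$, $I\subseteq\Sigma\times\Sigma$ irreflexive symmetric, $\mathcal{M}$ is $\Sigma^*$ modulo the congruence generated by $ab=ba$ for $(a,b)\in I$; unit $1$, length $|x|$, $x\le y$ iff $y=x\cdot z$. A clique is a trace $a_1\cdots a_k$ ($k\ge0$) of pairwise distinct letters pairwise in $I$; $\mathscr{C}$ is the set of cliques. Two cliques/letters are parallel, $c\parallel c'$, if $c\cdot c'$ is a clique. A partial action consists of nonempty subsets $\Sigma(\alpha)\subseteq\Sigma$ for $\alpha\in X_0$ and maps $\Sigma(\alpha)\to X_0$, $a\mapsto\alpha\cdot a$, such that whenever $a\in\Sigma(\alpha)$ and $a\parallel b$: either $b\in\Sigma(\alpha)$, and then $a\in\Sigma(\alpha\cdot b)$, $b\in\Sigma(\alpha\cdot a)$ and $(\alpha\cdot a)\cdot b=(\alpha\cdot b)\cdot a$; or $b\notin\Sigma(\alpha)$, and then $b\notin\Sigma(\alpha\cdot a)$. The associated total action is the unique right action of $\mathcal{M}$ on $X=X_0\cup\{\bot\}$ with $\alpha\cdot a$ as given for $a\in\Sigma(\alpha)$, $\alpha\cdot a=\bot$ for $a\notin\Sigma(\alpha)$,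 and $\bot\cdot a=\bot$. For $\alpha,\beta\in X_0$, $\mathcal{M}_{\alpha,\beta}=\{x\in\mathcal{M}:\alpha\cdot x=\beta\}$. A fibred formal series is a matrix $F=(F_{\alpha,\beta})_{\alpha,\beta\in X_0}$ of maps $F_{\alpha,\beta}:\mathcal{M}\to\mathbb{Z}$ with $F_{\alpha,\beta}(x)\neq0\Rightarrow x\in\mathcal{M}_{\alpha,\beta}$. Sum and scalar multiplication are termwise; the product is $(FG)_{\alpha,\gamma}(x)=\sum_{\beta\in X_0}\sum_{(y,z)\in\mathcal{M}_{\alpha,\beta}\times\mathcal{M}_{\beta,\gamma}:\,y\cdot z=x}F_{\alpha,\beta}(y)G_{\beta,\gamma}(z)$; the identity is $I_{\alpha,\beta}(x)=\mathbf{1}_{\{\alpha=\beta\}}\mathbf{1}_{\{x=1\}}$. The zeta series is $\zeta_{\alpha,\beta}(x)=\mathbf{1}_{\{x\in\mathcal{M}_{\alpha,\beta}\}}$ and the Möbius fibred polynomial is $\mu_{\alpha,\beta}(x)=(-1)^{|x|}\mathbf{1}_{\{x\in\mathscr{C}\cap\mathcal{M}_{\alpha,\beta}\}}$. *)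

theory Defs
  imports "HOL-Algebra.Module"
begin

inductive_set trace_cong :: "'a set \<Rightarrow> ('a \<times> 'a) set \<Rightarrow> ('a list \<times> 'a list) set"
  for A :: "'a set" and I :: "('a \<times> 'a) set" where
  tc_comm: "(a, b) \<in> I \<Longrightarrow> a \<in> A \<Longrightarrow> b \<in> A \<Longrightarrow> ([a, b], [b, a]) \<in> trace_cong A I"
| tc_refl: "u \<in> lists A \<Longrightarrow> (u, u) \<in> trace_cong A I"
| tc_sym: "(u, v) \<in> trace_cong A I \<Longrightarrow> (v, u) \<in> trace_cong A I"
| tc_trans: "(u, v) \<in> trace_cong A I \<Longrightarrow> (v, w) \<in> trace_cong A I \<Longrightarrow> (u, w) \<in> trace_cong A I"
| tc_append: "(u, u') \<in> trace_cong A I \<Longrightarrow> (v, v') \<in> trace_cong A I \<Longrightarrow>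
    (u @ v, u' @ v') \<in> trace_cong A I"

definition trace_of :: "'a set \<Rightarrow> ('a \<times> 'a) set \<Rightarrow> 'a list \<Rightarrow> 'a list set" where
  "trace_of A I w = trace_cong A I `` {w}"

definition trace_monoid :: "'a set \<Rightarrow> ('a \<times> 'a) set \<Rightarrow> 'a list set monoid" where
  "trace_monoid A I =
     \<lparr>carrier = lists A // trace_cong A I,
      mult = (\<lambda>x y. \<Union>u\<in>x. \<Union>v\<in>y. trace_of A I (u @ v)),
      one = trace_of A I []\<rparr>"

(* All representatives of a trace have the same length. *)
definition trace_length :: "'a list set \<Rightarrow> nat" where
  "trace_length x = the_elem (length ` x)"

definition cliques :: "'a set \<Rightarrow> ('a \<times> 'a) set \<Rightarrow> 'a list set set" where
  "cliques A I =
     {trace_of A I w | w. w \<in> lists A \<and> distinct w \<and> pairwise (\<lambda>a b. (a, b) \<in> I) (set w)}"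

definition parallel :: "'a set \<Rightarrow> ('a \<times> 'a) set \<Rightarrow> 'a list set \<Rightarrow> 'a list set \<Rightarrow> bool" where
  "parallel A I c c' \<longleftrightarrow>
     c \<in> cliques A I \<and> c' \<in> cliques A I \<and> c \<otimes>\<^bsub>trace_monoid A I\<^esub> c' \<in> cliques A I"

locale trace_alphabet =
  fixes A :: "'a set" and I :: "('a \<times> 'a) set"
  assumes finite_alphabet: "finite A"
    and card_alphabet: "card A \<ge> 2"
    and indep_subset: "I \<subseteq> A \<times> A"
    and indep_irrefl: "irrefl I"
    and indep_sym: "sym I"

(* E \<alpha> is the set of letters enabled in state \<alpha>; d \<alpha> a is only meaningful for a \<in> E \<alpha>. *)
locale partial_action = trace_alphabet A I
  for A :: "'a set" and I :: "('a \<times> 'a) set" +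
  fixes X0 :: "'s set" and E :: "'s \<Rightarrow> 'a set" and d :: "'s \<Rightarrow> 'a \<Rightarrow> 's"
  assumes enabled_subset: "\<alpha> \<in> X0 \<Longrightarrow> E \<alpha> \<subseteq> A"
    and enabled_nonempty: "\<alpha> \<in> X0 \<Longrightarrow> E \<alpha> \<noteq> {}"
    and act_closed: "\<alpha> \<in> X0 \<Longrightarrow> a \<in> E \<alpha> \<Longrightarrow> d \<alpha> a \<in> X0"
    and act_parallel:
      "\<alpha> \<in> X0 \<Longrightarrow> a \<in> E \<alpha> \<Longrightarrow> b \<in> A \<Longrightarrow> parallel A I (trace_of A I [a]) (trace_of A I [b]) \<Longrightarrow>
        (b \<in> E \<alpha> \<and> a \<in> E (d \<alpha> b) \<and> b \<in> E (d \<alpha> a) \<and> d (d \<alpha> a) b = d (d \<alpha> b) a)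
        \<or> (b \<notin> E \<alpha> \<and> b \<notin> E (d \<alpha> a))"

(* X = X0 \<union> {\<bottom>} is represented by the option type, with \<bottom> = None. *)
definition step :: "('s \<Rightarrow> 'a set) \<Rightarrow> ('s \<Rightarrow> 'a \<Rightarrow> 's) \<Rightarrow> 's option \<Rightarrow> 'a \<Rightarrow> 's option" where
  "step E d s a =
     (case s of None \<Rightarrow> None | Some \<alpha> \<Rightarrow> if a \<in> E \<alpha> then Some (d \<alpha> a) else None)"

(* Under the axioms of a partial action the result does not depend on the representative, and this
   is the unique right action extending step: see total_action_one, total_action_mult,
   total_action_letter and total_action_unique below. *)
definition total_action ::
    "('s \<Rightarrow> 'a set) \<Rightarrow> ('s \<Rightarrow> 'a \<Rightarrow> 's) \<Rightarrow> 's option \<Rightarrow> 'a list set \<Rightarrow> 's option" where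
  "total_action E d s x = the_elem (foldl (step E d) s ` x)"

definition fibre ::
    "'a set \<Rightarrow> ('a \<times> 'a) set \<Rightarrow> 's set \<Rightarrow> ('s \<Rightarrow> 'a set) \<Rightarrow> ('s \<Rightarrow> 'a \<Rightarrow> 's) \<Rightarrow>
      's \<Rightarrow> 's \<Rightarrow> 'a list set set" where
  "fibre A I X0 E d \<alpha> \<beta> =
     {x \<in> carrier (trace_monoid A I).
        \<alpha> \<in> X0 \<and> \<beta> \<in> X0 \<and> total_action E d (Some \<alpha>) x = Some \<beta>}"

type_synonym ('a, 's) fibred_series = "'s \<Rightarrow> 's \<Rightarrow> 'a list set \<Rightarrow> int"

(* A series is extended by 0 outside X0 \<times> X0 and outside the trace monoid (fibres with an index
   outside X0 are empty), so that equality of series is equality of functions. The sums in the product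
   are finite when X0 is, and the structure is then a ring: see ring_fibred_algebra below. *)
definition fibred_algebra ::
    "'a set \<Rightarrow> ('a \<times> 'a) set \<Rightarrow> 's set \<Rightarrow> ('s \<Rightarrow> 'a set) \<Rightarrow> ('s \<Rightarrow> 'a \<Rightarrow> 's) \<Rightarrow>
      (int, ('a, 's) fibred_series) module" where
  "fibred_algebra A I X0 E d =
     \<lparr>carrier = {F. \<forall>\<alpha> \<beta> x. F \<alpha> \<beta> x \<noteq> 0 \<longrightarrow> x \<in> fibre A I X0 E d \<alpha> \<beta>},
      mult = (\<lambda>F G \<alpha> \<gamma> x.
        \<Sum>\<beta>\<in>X0. \<Sum>(y, z)\<in>{(y, z). y \<in> fibre A I X0 E d \<alpha> \<beta> \<and> z \<in> fibre A I X0 E d \<beta> \<gamma> \<and>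
                                y \<otimes>\<^bsub>trace_monoid A I\<^esub> z = x}. F \<alpha> \<beta> y * G \<beta> \<gamma> z),
      one = (\<lambda>\<alpha> \<beta> x. of_bool (\<alpha> \<in> X0 \<and> \<alpha> = \<beta>) * of_bool (x = \<one>\<^bsub>trace_monoid A I\<^esub>)),
      zero = (\<lambda>\<alpha> \<beta> x. 0),
      add = (\<lambda>F G \<alpha> \<beta> x. F \<alpha> \<beta> x + G \<alpha> \<beta> x),
      smult = (\<lambda>k F \<alpha> \<beta> x. k * F \<alpha> \<beta> x)\<rparr>"

definition zeta ::
    "'a set \<Rightarrow> ('a \<times> 'a) set \<Rightarrow> 's set \<Rightarrow> ('s \<Rightarrow> 'a set) \<Rightarrow> ('s \<Rightarrow> 'a \<Rightarrow> 's) \<Rightarrow>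
      ('a, 's) fibred_series" where
  "zeta A I X0 E d \<alpha> \<beta> x = of_bool (x \<in> fibre A I X0 E d \<alpha> \<beta>)"

definition moebius ::
    "'a set \<Rightarrow> ('a \<times> 'a) set \<Rightarrow> 's set \<Rightarrow> ('s \<Rightarrow> 'a set) \<Rightarrow> ('s \<Rightarrow> 'a \<Rightarrow> 's) \<Rightarrow>
      ('a, 's) fibred_series" where
  "moebius A I X0 E d \<alpha> \<beta> x =
     (- 1) ^ trace_length x * of_bool (x \<in> cliques A I \<inter> fibre A I X0 E d \<alpha> \<beta>)"

lemma trace_cong_lists: "(u, v) \<in> trace_cong A I \<Longrightarrow> u \<in> lists A \<and> v \<in> lists A"
  by (induction rule: trace_cong.induct) auto

lemma equiv_trace_cong: "equiv (lists A) (trace_cong A I)"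
proof (rule equivI)
  show "trace_cong A I \<subseteq> lists A \<times> lists A" using trace_cong_lists by fastforce
  show "refl_on (lists A) (trace_cong A I)"
    by (auto simp: refl_on_def intro: trace_cong.tc_refl)
  show "sym_on UNIV (trace_cong A I)" by (auto intro: symI trace_cong.tc_sym)
  show "trans_on UNIV (trace_cong A I)" by (auto intro: transI trace_cong.tc_trans)
qed

lemma trace_of_eq_iff:
  "u \<in> lists A \<Longrightarrow> v \<in> lists A \<Longrightarrow> trace_of A I u = trace_of A I v \<longleftrightarrow> (u, v) \<in> trace_cong A I"
  unfolding trace_of_def by (rule eq_equiv_class_iff[OF equiv_trace_cong])

lemma trace_of_self: "u \<in> lists A \<Longrightarrow> u \<in> trace_of A I u"
  by (simp add: trace_of_def trace_cong.tc_refl)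

lemma in_carrier_iff:
  "x \<in> carrier (trace_monoid A I) \<longleftrightarrow> (\<exists>u \<in> lists A. x = trace_of A I u)"
  by (auto simp: trace_monoid_def trace_of_def quotient_def)

lemma trace_one: "\<one>\<^bsub>trace_monoid A I\<^esub> = trace_of A I []"
  by (simp add: trace_monoid_def)

lemma trace_mult:
  assumes "u \<in> lists A" "v \<in> lists A"
  shows "trace_of A I u \<otimes>\<^bsub>trace_monoid A I\<^esub> trace_of A I v = trace_of A I (u @ v)"
proof -
  have *: "trace_of A I (u' @ v') = trace_of A I (u @ v)"
    if "u' \<in> trace_of A I u" "v' \<in> trace_of A I v" for u' v'
    using that assms trace_cong_lists[of u u' A I] trace_cong_lists[of v v' A I]
    by (subst trace_of_eq_iff) (auto simp: trace_of_def intro: trace_cong.tc_append trace_cong.tc_sym)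
  have "trace_of A I u \<otimes>\<^bsub>trace_monoid A I\<^esub> trace_of A I v =
      (\<Union>u'\<in>trace_of A I u. \<Union>v'\<in>trace_of A I v. trace_of A I (u' @ v'))"
    by (simp add: trace_monoid_def)
  also have "\<dots> = (\<Union>u'\<in>trace_of A I u. \<Union>v'\<in>trace_of A I v. trace_of A I (u @ v))"
    using * by simp
  also have "\<dots> = trace_of A I (u @ v)"
    using trace_of_self[OF assms(1), of I] trace_of_self[OF assms(2), of I] by auto
  finally show ?thesis .
qed

lemma monoid_trace_monoid: "monoid (trace_monoid A I)"
proof (rule monoidI)
  show "\<one>\<^bsub>trace_monoid A I\<^esub> \<in> carrier (trace_monoid A I)"
    by (auto simp: in_carrier_iff trace_one)
next
  fix x y z
  assume "x \<in> carrier (trace_monoid A I)" "y \<in> carrier (trace_monoid A I)"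
    "z \<in> carrier (trace_monoid A I)"
  then obtain u v w where *: "u \<in> lists A" "v \<in> lists A" "w \<in> lists A"
      "x = trace_of A I u" "y = trace_of A I v" "z = trace_of A I w"
    unfolding in_carrier_iff by blast
  then have app: "u @ v \<in> lists A" "v @ w \<in> lists A" by auto
  show "x \<otimes>\<^bsub>trace_monoid A I\<^esub> y \<in> carrier (trace_monoid A I)"
    using app unfolding *(4,5) trace_mult[OF *(1,2)] in_carrier_iff by blast
  show "x \<otimes>\<^bsub>trace_monoid A I\<^esub> y \<otimes>\<^bsub>trace_monoid A I\<^esub> z =
      x \<otimes>\<^bsub>trace_monoid A I\<^esub> (y \<otimes>\<^bsub>trace_monoid A I\<^esub> z)"
    unfolding *(4-6) trace_mult[OF *(1,2)] trace_mult[OF *(2,3)] trace_mult[OF app(1) *(3)]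
      trace_mult[OF *(1) app(2)] by simp
next
  fix x assume "x \<in> carrier (trace_monoid A I)"
  then obtain u where *: "u \<in> lists A" "x = trace_of A I u"
    unfolding in_carrier_iff by blast
  have nil: "[] \<in> lists A" by simp
  show "\<one>\<^bsub>trace_monoid A I\<^esub> \<otimes>\<^bsub>trace_monoid A I\<^esub> x = x"
    unfolding *(2) trace_one trace_mult[OF nil *(1)] by simp
  show "x \<otimes>\<^bsub>trace_monoid A I\<^esub> \<one>\<^bsub>trace_monoid A I\<^esub> = x"
    unfolding *(2) trace_one trace_mult[OF *(1) nil] by simp
qed

lemma trace_cong_length: "(u, v) \<in> trace_cong A I \<Longrightarrow> length u = length v"
  by (induction rule: trace_cong.induct) auto

lemma trace_length_trace_of:
  assumes "u \<in> lists A"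
  shows "trace_length (trace_of A I u) = length u"
proof -
  have "length v = length u" if "v \<in> trace_of A I u" for v
    using that trace_cong_length[of u v A I] by (simp add: trace_of_def)
  with trace_of_self[OF assms, of I] have "length ` trace_of A I u = {length u}" by blast
  then show ?thesis by (simp add: trace_length_def)
qed

lemma finite_factorizations:
  assumes "finite A"
  shows "finite {(y, z). y \<in> carrier (trace_monoid A I) \<and> z \<in> carrier (trace_monoid A I) \<and>
      y \<otimes>\<^bsub>trace_monoid A I\<^esub> z = x}"
proof -
  let ?T = "trace_of A I ` {u. set u \<subseteq> A \<and> length u \<le> trace_length x}"
  have "finite ?T" using finite_lists_length_le[OF assms] by blast
  moreover have "{(y, z). y \<in> carrier (trace_monoid A I) \<and> z \<in> carrier (trace_monoid A I) \<and>
      y \<otimes>\<^bsub>trace_monoid A I\<^esub> z = x} \<subseteq> ?T \<times> ?T"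
  proof (clarsimp simp: in_carrier_iff)
    fix u v assume uv: "\<forall>a\<in>set u. a \<in> A" "\<forall>a\<in>set v. a \<in> A"
      "x = trace_of A I u \<otimes>\<^bsub>trace_monoid A I\<^esub> trace_of A I v"
    then have "trace_length (trace_of A I u \<otimes>\<^bsub>trace_monoid A I\<^esub> trace_of A I v) = length u + length v"
      using trace_length_trace_of[of "u @ v" A I] by (simp add: trace_mult in_lists_conv_set ball_Un)
    with uv show "trace_of A I u \<in> trace_of A I ` {ua. set ua \<subseteq> A \<and> length ua \<le>
          trace_length (trace_of A I u \<otimes>\<^bsub>trace_monoid A I\<^esub> trace_of A I v)} \<and>
        trace_of A I v \<in> trace_of A I ` {ua. set ua \<subseteq> A \<and> length ua \<le>
          trace_length (trace_of A I u \<otimes>\<^bsub>trace_monoid A I\<^esub> trace_of A I v)}"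
      by auto
  qed
  ultimately show ?thesis using finite_subset[OF _ finite_cartesian_product[of ?T ?T]] by simp
qed

context trace_alphabet
begin

lemma parallel_letters:
  assumes "(a, b) \<in> I"
  shows "parallel A I (trace_of A I [a]) (trace_of A I [b])"
proof -
  have ab: "a \<in> A" "b \<in> A" "a \<noteq> b" "(b, a) \<in> I"
    using assms indep_subset indep_irrefl indep_sym by (auto simp: irrefl_def dest: symD)
  have "trace_of A I w \<in> cliques A I" if "w \<in> {[a], [b], [a, b]}" for w
    unfolding cliques_def using that ab assms by (auto simp: pairwise_def intro!: exI[of _ w])
  then show ?thesis using ab by (simp add: parallel_def trace_mult)
qed

end

context partial_action
begin

abbreviation states :: "'s option set" where
  "states \<equiv> insert None (Some ` X0)"

lemma step_closed: "s \<in> states \<Longrightarrow> step E d s a \<in> states"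
  by (auto simp: step_def act_closed)

lemma foldl_step_closed: "s \<in> states \<Longrightarrow> foldl (step E d) s w \<in> states"
  by (induction w arbitrary: s) (simp_all only: foldl.simps step_closed)

lemma step_commute:
  assumes "(a, b) \<in> I" "s \<in> states"
  shows "step E d (step E d s a) b = step E d (step E d s b) a"
proof (cases s)
  case (Some \<alpha>)
  have ab: "a \<in> A" "b \<in> A" "(b, a) \<in> I"
    using assms(1) indep_subset indep_sym by (auto dest: symD)
  have \<alpha>: "\<alpha> \<in> X0" using assms(2) Some by auto
  show ?thesis
    using act_parallel[OF \<alpha> _ ab(2) parallel_letters[OF assms(1)]]
      act_parallel[OF \<alpha> _ ab(1) parallel_letters[OF ab(3)]]
    by (auto simp: step_def Some)
qed (simp add: step_def)

lemma foldl_step_cong: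
  "(u, v) \<in> trace_cong A I \<Longrightarrow> s \<in> states \<Longrightarrow> foldl (step E d) s u = foldl (step E d) s v"
proof (induction arbitrary: s rule: trace_cong.induct)
  case (tc_comm a b)
  show ?case using step_commute[OF tc_comm(1) tc_comm(4)] by simp
next
  case (tc_append u u' v v')
  then show ?case by (simp only: foldl_append foldl_step_closed)
qed simp_all

lemma total_action_trace_of:
  assumes "s \<in> states" "u \<in> lists A"
  shows "total_action E d s (trace_of A I u) = foldl (step E d) s u"
proof -
  have "foldl (step E d) s ` trace_of A I u = {foldl (step E d) s u}"
  proof (rule antisym; rule subsetI)
    fix t assume "t \<in> foldl (step E d) s ` trace_of A I u"
    then obtain v where "(u, v) \<in> trace_cong A I" "t = foldl (step E d) s v"
      by (auto simp: trace_of_def)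
    with foldl_step_cong[OF this(1) assms(1)] show "t \<in> {foldl (step E d) s u}" by simp
  next
    fix t assume "t \<in> {foldl (step E d) s u}"
    then show "t \<in> foldl (step E d) s ` trace_of A I u"
      using trace_of_self[OF assms(2), of I] by blast
  qed
  then show ?thesis by (simp add: total_action_def)
qed

lemma total_action_letter:
  assumes "s \<in> states" "a \<in> A"
  shows "total_action E d s (trace_of A I [a]) = step E d s a"
  using total_action_trace_of[OF assms(1), of "[a]"] assms(2) by simp

lemma total_action_one:
  assumes "s \<in> states"
  shows "total_action E d s \<one>\<^bsub>trace_monoid A I\<^esub> = s"
  using total_action_trace_of[OF assms, of "[]"] by (simp add: trace_one)

lemma total_action_closed:
  assumes "s \<in> states" "x \<in> carrier (trace_monoid A I)"
  shows "total_action E d s x \<in> states"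
  using assms(2) foldl_step_closed[OF assms(1)] total_action_trace_of[OF assms(1)]
  unfolding in_carrier_iff by metis

lemma total_action_mult:
  assumes "s \<in> states" "x \<in> carrier (trace_monoid A I)" "y \<in> carrier (trace_monoid A I)"
  shows "total_action E d s (x \<otimes>\<^bsub>trace_monoid A I\<^esub> y) = total_action E d (total_action E d s x) y"
proof -
  obtain u v where uv: "u \<in> lists A" "v \<in> lists A" "x = trace_of A I u" "y = trace_of A I v"
    using assms(2,3) unfolding in_carrier_iff by blast
  then show ?thesis
    using total_action_trace_of[OF assms(1), of "u @ v"] total_action_trace_of[OF assms(1), of u]
      total_action_trace_of[OF foldl_step_closed[OF assms(1)], of v u]
    by (simp add: trace_mult)
qed

lemma total_action_unique:
  assumes one: "\<And>s. s \<in> states \<Longrightarrow> f s \<one>\<^bsub>trace_monoid A I\<^esub> = s"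
    and mult: "\<And>s x y. s \<in> states \<Longrightarrow> x \<in> carrier (trace_monoid A I) \<Longrightarrow>
      y \<in> carrier (trace_monoid A I) \<Longrightarrow> f s (x \<otimes>\<^bsub>trace_monoid A I\<^esub> y) = f (f s x) y"
    and letter: "\<And>s a. s \<in> states \<Longrightarrow> a \<in> A \<Longrightarrow> f s (trace_of A I [a]) = step E d s a"
    and s: "s \<in> states" and x: "x \<in> carrier (trace_monoid A I)"
  shows "f s x = total_action E d s x"
proof -
  have "f s (trace_of A I u) = foldl (step E d) s u" if "u \<in> lists A" for u
    using that s
  proof (induction u arbitrary: s rule: list.induct)
    case Nil
    then show ?case using one[of s] by (simp add: trace_one)
  next
    case (Cons a u)
    have a: "a \<in> A" and u: "u \<in> lists A" using Cons.prems by auto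
    have "f s (trace_of A I (a # u)) = f (f s (trace_of A I [a])) (trace_of A I u)"
      using mult[OF Cons.prems(2), of "trace_of A I [a]" "trace_of A I u"] a u trace_mult[of "[a]" A u I]
        in_carrier_iff[of "trace_of A I [a]" A I] in_carrier_iff[of "trace_of A I u" A I]
      by (metis append_Cons append_Nil lists.simps)
    also have "\<dots> = foldl (step E d) (step E d s a) u"
      using Cons.IH[OF u step_closed[OF Cons.prems(2)]] letter[OF Cons.prems(2) a] by simp
    finally show ?case by simp
  qed
  with x s total_action_trace_of show ?thesis unfolding in_carrier_iff by metis
qed

abbreviation alg where "alg \<equiv> fibred_algebra A I X0 E d"
abbreviation fib where "fib \<equiv> fibre A I X0 E d"
definition fact_pairs where
  "fact_pairs x = {(y, z). y \<in> carrier (trace_monoid A I) \<and> z \<in> carrier (trace_monoid A I) \<and>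
     y \<otimes>\<^bsub>trace_monoid A I\<^esub> z = x}"

lemma finite_fact_pairs: "finite (fact_pairs x)"
  unfolding fact_pairs_def by (rule finite_factorizations[OF finite_alphabet])

lemma in_fact_pairs: "(y, z) \<in> fact_pairs x \<longleftrightarrow>
    y \<in> carrier (trace_monoid A I) \<and> z \<in> carrier (trace_monoid A I) \<and> y \<otimes>\<^bsub>trace_monoid A I\<^esub> z = x"
  by (simp add: fact_pairs_def)

lemma in_alg: "F \<in> carrier alg \<longleftrightarrow> (\<forall>\<alpha> \<beta> x. F \<alpha> \<beta> x \<noteq> 0 \<longrightarrow> x \<in> fib \<alpha> \<beta>)"
  by (simp add: fibred_algebra_def)

lemma fibre_mult:
  assumes "x \<in> fib \<alpha> \<beta>" "y \<in> fib \<beta> \<gamma>"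
  shows "x \<otimes>\<^bsub>trace_monoid A I\<^esub> y \<in> fib \<alpha> \<gamma>"
  using assms total_action_mult[of "Some \<alpha>" x y] monoid.m_closed[OF monoid_trace_monoid]
  by (auto simp: fibre_def)

lemma mult_alg:
  assumes "F \<in> carrier alg" "G \<in> carrier alg"
  shows "(F \<otimes>\<^bsub>alg\<^esub> G) \<alpha> \<gamma> x = (\<Sum>\<beta>\<in>X0. \<Sum>(y, z)\<in>fact_pairs x. F \<alpha> \<beta> y * G \<beta> \<gamma> z)"
proof -
  have "(\<Sum>(y, z)\<in>{(y, z). y \<in> fib \<alpha> \<beta> \<and> z \<in> fib \<beta> \<gamma> \<and> y \<otimes>\<^bsub>trace_monoid A I\<^esub> z = x}. F \<alpha> \<beta> y * G \<beta> \<gamma> z)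
    = (\<Sum>(y, z)\<in>fact_pairs x. F \<alpha> \<beta> y * G \<beta> \<gamma> z)" for \<beta>
  proof (rule sum.mono_neutral_left[OF finite_fact_pairs])
    show "{(y, z). y \<in> fib \<alpha> \<beta> \<and> z \<in> fib \<beta> \<gamma> \<and> y \<otimes>\<^bsub>trace_monoid A I\<^esub> z = x} \<subseteq> fact_pairs x"
      by (auto simp: fibre_def in_fact_pairs)
  qed (use assms in \<open>auto simp: fibred_algebra_def in_fact_pairs\<close>)
  then show ?thesis by (simp add: fibred_algebra_def)
qed

lemma mult_alg_closed:
  assumes "F \<in> carrier alg" "G \<in> carrier alg"
  shows "F \<otimes>\<^bsub>alg\<^esub> G \<in> carrier alg"
proof -
  have "x \<in> fib \<alpha> \<gamma>" if nz: "(F \<otimes>\<^bsub>alg\<^esub> G) \<alpha> \<gamma> x \<noteq> 0" for \<alpha> \<gamma> x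
  proof -
    obtain \<beta> where "(\<Sum>(y, z)\<in>fact_pairs x. F \<alpha> \<beta> y * G \<beta> \<gamma> z) \<noteq> 0"
      using nz unfolding mult_alg[OF assms] by (rule sum.not_neutral_contains_not_neutral)
    then obtain p where "p \<in> fact_pairs x" "(case p of (y, z) \<Rightarrow> F \<alpha> \<beta> y * G \<beta> \<gamma> z) \<noteq> 0"
      by (rule sum.not_neutral_contains_not_neutral)
    then obtain y z where yz: "F \<alpha> \<beta> y * G \<beta> \<gamma> z \<noteq> 0" "y \<otimes>\<^bsub>trace_monoid A I\<^esub> z = x"
      by (cases p) (simp add: in_fact_pairs)
    then have "y \<in> fib \<alpha> \<beta>" "z \<in> fib \<beta> \<gamma>" using assms unfolding in_alg by auto
    then show ?thesis using fibre_mult yz(2) by blast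
  qed
  then show ?thesis unfolding in_alg by blast
qed

lemma one_alg_closed: "\<one>\<^bsub>alg\<^esub> \<in> carrier alg"
  using monoid.one_closed[OF monoid_trace_monoid, of A I]
  by (auto simp: fibred_algebra_def fibre_def total_action_one)

lemma mult_alg_assoc:
  assumes F: "F \<in> carrier alg" and G: "G \<in> carrier alg" and H: "H \<in> carrier alg"
  shows "(F \<otimes>\<^bsub>alg\<^esub> G) \<otimes>\<^bsub>alg\<^esub> H = F \<otimes>\<^bsub>alg\<^esub> (G \<otimes>\<^bsub>alg\<^esub> H)"
proof (intro ext)
  interpret M: monoid "trace_monoid A I" by (rule monoid_trace_monoid)
  fix \<alpha> \<delta> x
  have *: "(\<Sum>p\<in>fact_pairs x. \<Sum>q\<in>fact_pairs (fst p). F \<alpha> \<beta> (fst q) * G \<beta> \<gamma> (snd q) * H \<gamma> \<delta> (snd p))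
    = (\<Sum>p\<in>fact_pairs x. \<Sum>q\<in>fact_pairs (snd p). F \<alpha> \<beta> (fst p) * G \<beta> \<gamma> (fst q) * H \<gamma> \<delta> (snd q))" for \<beta> \<gamma>
  proof -
    let ?f = "\<lambda>u v z. F \<alpha> \<beta> u * G \<beta> \<gamma> v * H \<gamma> \<delta> z"
    have "(\<Sum>p\<in>fact_pairs x. \<Sum>q\<in>fact_pairs (fst p). ?f (fst q) (snd q) (snd p)) =
      (\<Sum>(p, q)\<in>(SIGMA p:fact_pairs x. fact_pairs (fst p)). ?f (fst q) (snd q) (snd p))"
      by (rule sum.Sigma) (simp_all add: finite_fact_pairs)
    also have "\<dots> = (\<Sum>(p, q)\<in>(SIGMA p:fact_pairs x. fact_pairs (snd p)). ?f (fst p) (fst q) (snd q))"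
      by (rule sum.reindex_bij_witness[where
          i = "\<lambda>((u, w), (v, z)). ((u \<otimes>\<^bsub>trace_monoid A I\<^esub> v, z), (u, v))" and
          j = "\<lambda>((w, z), (u, v)). ((u, v \<otimes>\<^bsub>trace_monoid A I\<^esub> z), (v, z))"])
        (auto simp: M.m_assoc in_fact_pairs)
    also have "\<dots> = (\<Sum>p\<in>fact_pairs x. \<Sum>q\<in>fact_pairs (snd p). ?f (fst p) (fst q) (snd q))"
      by (rule sum.Sigma[symmetric]) (simp_all add: finite_fact_pairs)
    finally show ?thesis .
  qed
  have "((F \<otimes>\<^bsub>alg\<^esub> G) \<otimes>\<^bsub>alg\<^esub> H) \<alpha> \<delta> x = (\<Sum>\<gamma>\<in>X0. \<Sum>\<beta>\<in>X0. \<Sum>p\<in>fact_pairs x. \<Sum>q\<in>fact_pairs (fst p).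
      F \<alpha> \<beta> (fst q) * G \<beta> \<gamma> (snd q) * H \<gamma> \<delta> (snd p))"
    unfolding mult_alg[OF mult_alg_closed[OF F G] H] mult_alg[OF F G] case_prod_beta sum_distrib_right
    by (rule sum.cong[OF refl], rule sum.swap)
  also have "\<dots> = (\<Sum>\<beta>\<in>X0. \<Sum>\<gamma>\<in>X0. \<Sum>p\<in>fact_pairs x. \<Sum>q\<in>fact_pairs (snd p).
      F \<alpha> \<beta> (fst p) * G \<beta> \<gamma> (fst q) * H \<gamma> \<delta> (snd q))"
    unfolding * by (rule sum.swap)
  also have "\<dots> = (F \<otimes>\<^bsub>alg\<^esub> (G \<otimes>\<^bsub>alg\<^esub> H)) \<alpha> \<delta> x"
    unfolding mult_alg[OF F mult_alg_closed[OF G H]] mult_alg[OF G H] case_prod_beta sum_distrib_left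
      mult.assoc
    by (rule sum.cong[OF refl], rule sum.swap)
  finally show "((F \<otimes>\<^bsub>alg\<^esub> G) \<otimes>\<^bsub>alg\<^esub> H) \<alpha> \<delta> x = (F \<otimes>\<^bsub>alg\<^esub> (G \<otimes>\<^bsub>alg\<^esub> H)) \<alpha> \<delta> x" .
qed

lemma alg_one_mult:
  assumes fin: "finite X0" and F: "F \<in> carrier alg"
  shows "\<one>\<^bsub>alg\<^esub> \<otimes>\<^bsub>alg\<^esub> F = F" "F \<otimes>\<^bsub>alg\<^esub> \<one>\<^bsub>alg\<^esub> = F"
proof -
  interpret M: monoid "trace_monoid A I" by (rule monoid_trace_monoid)
  let ?e = "\<one>\<^bsub>trace_monoid A I\<^esub>"
  have supp: "F \<alpha> \<beta> x = 0" if "\<alpha> \<notin> X0 \<or> \<beta> \<notin> X0 \<or> x \<notin> carrier (trace_monoid A I)" for \<alpha> \<beta> x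
    using F that by (auto simp: fibred_algebra_def fibre_def)
  have 1: "(\<Sum>(y, z)\<in>fact_pairs x. \<one>\<^bsub>alg\<^esub> \<alpha> \<beta> y * F \<beta> \<gamma> z) = (if \<beta> = \<alpha> then F \<alpha> \<gamma> x else 0)" for \<alpha> \<beta> \<gamma> x
  proof -
    have "(\<Sum>(y, z)\<in>fact_pairs x. \<one>\<^bsub>alg\<^esub> \<alpha> \<beta> y * F \<beta> \<gamma> z) =
      (\<Sum>p\<in>fact_pairs x. if p = (?e, x) then (if \<beta> = \<alpha> then F \<alpha> \<gamma> x else 0) else 0)"
      by (rule sum.cong) (auto simp: fibred_algebra_def supp in_fact_pairs)
    then show ?thesis using finite_fact_pairs[of x] supp by (auto simp: sum.delta' in_fact_pairs)
  qed
  have 2: "(\<Sum>(y, z)\<in>fact_pairs x. F \<alpha> \<beta> y * \<one>\<^bsub>alg\<^esub> \<beta> \<gamma> z) = (if \<beta> = \<gamma> then F \<alpha> \<gamma> x else 0)" for \<alpha> \<beta> \<gamma> x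
  proof -
    have "(\<Sum>(y, z)\<in>fact_pairs x. F \<alpha> \<beta> y * \<one>\<^bsub>alg\<^esub> \<beta> \<gamma> z) =
      (\<Sum>p\<in>fact_pairs x. if p = (x, ?e) then (if \<beta> = \<gamma> then F \<alpha> \<gamma> x else 0) else 0)"
      by (rule sum.cong) (auto simp: fibred_algebra_def supp in_fact_pairs)
    then show ?thesis using finite_fact_pairs[of x] supp by (auto simp: sum.delta' in_fact_pairs)
  qed
  show "\<one>\<^bsub>alg\<^esub> \<otimes>\<^bsub>alg\<^esub> F = F" "F \<otimes>\<^bsub>alg\<^esub> \<one>\<^bsub>alg\<^esub> = F"
    by (intro ext; simp add: mult_alg one_alg_closed F 1 2 fin supp)+
qed

lemma ring_fibred_algebra:
  assumes "finite X0"
  shows "ring (fibred_algebra A I X0 E d)"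
proof (rule ringI)
  show "abelian_group alg"
  proof (rule abelian_groupI)
    fix F assume F: "F \<in> carrier alg"
    show "\<exists>G\<in>carrier alg. G \<oplus>\<^bsub>alg\<^esub> F = \<zero>\<^bsub>alg\<^esub>"
      by (rule bexI[of _ "\<lambda>\<alpha> \<beta> x. - F \<alpha> \<beta> x"]) (use F in \<open>auto simp: fibred_algebra_def\<close>)
  next
    fix F G assume FG: "F \<in> carrier alg" "G \<in> carrier alg"
    have "x \<in> fib \<alpha> \<beta>" if "F \<alpha> \<beta> x + G \<alpha> \<beta> x \<noteq> 0" for \<alpha> \<beta> x
      using FG that by (cases "F \<alpha> \<beta> x = 0") (auto simp: fibred_algebra_def)
    then show "F \<oplus>\<^bsub>alg\<^esub> G \<in> carrier alg" by (simp add: fibred_algebra_def)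
  qed (auto simp: fibred_algebra_def algebra_simps)
  then have add: "F \<oplus>\<^bsub>alg\<^esub> G \<in> carrier alg" if "F \<in> carrier alg" "G \<in> carrier alg" for F G
    using that by (rule abelian_monoid.a_closed[OF abelian_group.axioms(1)])
  have plus: "(F \<oplus>\<^bsub>alg\<^esub> G) = (\<lambda>\<alpha> \<beta> x. F \<alpha> \<beta> x + G \<alpha> \<beta> x)" for F G
    by (simp add: fibred_algebra_def)
  have "F \<otimes>\<^bsub>alg\<^esub> H \<oplus>\<^bsub>alg\<^esub> G \<otimes>\<^bsub>alg\<^esub> H = (F \<oplus>\<^bsub>alg\<^esub> G) \<otimes>\<^bsub>alg\<^esub> H"
    "H \<otimes>\<^bsub>alg\<^esub> F \<oplus>\<^bsub>alg\<^esub> H \<otimes>\<^bsub>alg\<^esub> G = H \<otimes>\<^bsub>alg\<^esub> (F \<oplus>\<^bsub>alg\<^esub> G)"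
    if "F \<in> carrier alg" "G \<in> carrier alg" "H \<in> carrier alg" for F G H
    using that add[OF that(1,2)]
    by (auto simp: mult_alg plus fun_eq_iff sum.distrib[symmetric] algebra_simps intro!: sum.cong)
  then show "(F \<oplus>\<^bsub>alg\<^esub> G) \<otimes>\<^bsub>alg\<^esub> H = F \<otimes>\<^bsub>alg\<^esub> H \<oplus>\<^bsub>alg\<^esub> G \<otimes>\<^bsub>alg\<^esub> H"
    "H \<otimes>\<^bsub>alg\<^esub> (F \<oplus>\<^bsub>alg\<^esub> G) = H \<otimes>\<^bsub>alg\<^esub> F \<oplus>\<^bsub>alg\<^esub> H \<otimes>\<^bsub>alg\<^esub> G"
    if "F \<in> carrier alg" "G \<in> carrier alg" "H \<in> carrier alg" for F G H
    using that by simp_all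
  show "monoid alg"
    by (rule monoidI)
      (simp_all only: mult_alg_closed one_alg_closed mult_alg_assoc alg_one_mult[OF assms])
qed

end

end

theory Submission
  imports Defs
begin

text \<open>
  A factorization of a trace determines the intermediate state of the action, so both products reduce
  to the Cartier--Foata identity for the trace monoid: the alternating sum of the cliques that divide
  \<open>x\<close> from the left vanishes for \<open>x \<noteq> 1\<close>. By cancellativity these cliques correspond to the subsets of
  the set of letters that divide \<open>x\<close> from the left, which is non-empty. Reversing words turns left
  divisors into right divisors.
\<close>

section \<open>First letters and cancellation on words\<close>

text \<open>A letter is collected when some occurrence of it is independent of every earlier letter.
  For an independence relation these are the letters that divide the trace of the word from the
  left.\<close>

primrec first_letters :: "('a \<times> 'a) set \<Rightarrow> 'a list \<Rightarrow> 'a set" where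
  "first_letters I [] = {}"
| "first_letters I (b # u) = insert b {a \<in> first_letters I u. (b, a) \<in> I}"

text \<open>All representatives of a trace have the same set of letters, so the union merely avoids
  choosing one of them.\<close>

definition letters :: "'a list set \<Rightarrow> 'a set" where
  "letters x = \<Union>(set ` x)"

lemma first_letters_subset: "first_letters I u \<subseteq> set u"
  by (induction u) auto

lemma first_letters_append:
  "first_letters I (u @ v) = first_letters I u \<union> {a \<in> first_letters I v. \<forall>b\<in>set u. (b, a) \<in> I}"
  by (induction u) auto

lemma first_letters_clique:
  "distinct w \<Longrightarrow> pairwise (\<lambda>a b. (a, b) \<in> I) (set w) \<Longrightarrow> first_letters I w = set w"
  by (induction w) (auto simp: pairwise_insert)

lemma trace_cong_set: "(u, v) \<in> trace_cong A I \<Longrightarrow> set u = set v"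
  by (induction rule: trace_cong.induct) auto

lemma trace_cong_rev: "(u, v) \<in> trace_cong A I \<Longrightarrow> (rev u, rev v) \<in> trace_cong A I"
proof (induction rule: trace_cong.induct)
  case (tc_trans u v w)
  then show ?case by (blast intro: trace_cong.tc_trans)
qed (auto intro: trace_cong.tc_comm trace_cong.tc_refl trace_cong.tc_sym trace_cong.tc_append)

lemma trace_cong_Cons: "a \<in> A \<Longrightarrow> (u, v) \<in> trace_cong A I \<Longrightarrow> (a # u, a # v) \<in> trace_cong A I"
  using trace_cong.tc_append[OF trace_cong.tc_refl[of "[a]"], of A u v I] by simp

text \<open>The source of left cancellation. In a concatenation, congruent left factors have the
  same letters, so the deletion hits the same factor on both sides.\<close>

lemma trace_cong_remove1:
  "(u, v) \<in> trace_cong A I \<Longrightarrow> (remove1 a u, remove1 a v) \<in> trace_cong A I"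
proof (induction rule: trace_cong.induct)
  case (tc_refl u)
  then show ?case using set_remove1_subset[of a u] by (auto intro: trace_cong.tc_refl)
next
  case (tc_append u u' v v')
  then show ?case
    using trace_cong_set[OF tc_append.hyps(1)] by (auto simp: remove1_append intro: trace_cong.tc_append)
next
  case (tc_trans u v w)
  then show ?case by (blast intro: trace_cong.tc_trans)
qed (auto intro: trace_cong.tc_comm trace_cong.tc_refl trace_cong.tc_sym)

text \<open>Deleting the first occurrence of the head letter strips it from both words, so the
  common prefix vanishes letter by letter.\<close>

lemma trace_cong_left_cancel: "(w @ u, w @ v) \<in> trace_cong A I \<Longrightarrow> (u, v) \<in> trace_cong A I"
proof (induction w)
  case (Cons a w)
  then show ?case using trace_cong_remove1[of "a # w @ u" "a # w @ v" A I a] by simp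
qed simp

lemma letters_trace_of:
  assumes "u \<in> lists A"
  shows "letters (trace_of A I u) = set u"
proof -
  have "set v = set u" if "v \<in> trace_of A I u" for v
    using that by (simp add: trace_of_def trace_cong_set)
  with trace_of_self[OF assms, of I] have "set ` trace_of A I u = {set u}" by blast
  then show ?thesis by (simp add: letters_def)
qed

section \<open>Reversal as an anti-automorphism of the trace monoid\<close>

text \<open>Reversal respects the congruence and is an involution, which gives the two
  inclusions.\<close>

lemma rev_image_trace_of: "rev ` trace_of A I u = trace_of A I (rev u)"
proof -
  have "v \<in> rev ` trace_of A I u" if "v \<in> trace_of A I (rev u)" for v
    using that trace_cong_rev[of "rev u" v A I] 
    by (auto simp: trace_of_def intro: image_eqI[of _ _ "rev v"])
  then show ?thesis using trace_cong_rev[of u _ A I] by (auto simp: trace_of_def)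
qed

lemma clique_obtain:
  assumes "y \<in> cliques A I"
  obtains w where "w \<in> lists A" "distinct w" "pairwise (\<lambda>a b. (a, b) \<in> I) (set w)"
    "y = trace_of A I w"
  using assms by (auto simp: cliques_def)

lemma rev_image_cliques:
  assumes "x \<in> cliques A I"
  shows "rev ` x \<in> cliques A I"
proof -
  obtain w where w: "x = trace_of A I w" "w \<in> lists A" "distinct w"
    "pairwise (\<lambda>a b. (a, b) \<in> I) (set w)"
    using clique_obtain[OF assms] by blast
  then show ?thesis
    unfolding cliques_def
    by (intro CollectI exI[of _ "rev w"]) (simp add: rev_image_trace_of in_lists_conv_set)
qed

lemma trace_length_rev_image: "trace_length (rev ` x) = trace_length x"
  by (simp add: trace_length_def image_image)

lemma rev_image_carrier:
  assumes "x \<in> carrier (trace_monoid A I)"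
  shows "rev ` x \<in> carrier (trace_monoid A I)"
proof -
  obtain u where "u \<in> lists A" "x = trace_of A I u" using assms unfolding in_carrier_iff by blast
  then show ?thesis
    unfolding in_carrier_iff
    by (intro bexI[of _ "rev u"]) (simp_all add: rev_image_trace_of in_lists_conv_set)
qed

lemma rev_image_mult:
  assumes "x \<in> carrier (trace_monoid A I)" "y \<in> carrier (trace_monoid A I)"
  shows "rev ` (x \<otimes>\<^bsub>trace_monoid A I\<^esub> y) = rev ` y \<otimes>\<^bsub>trace_monoid A I\<^esub> rev ` x"
proof -
  obtain u v where "u \<in> lists A" "v \<in> lists A" "x = trace_of A I u" "y = trace_of A I v"
    using assms unfolding in_carrier_iff by blast
  then show ?thesis by (simp add: trace_mult rev_image_trace_of in_lists_conv_set)
qed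

section \<open>Cliques as left divisors\<close>

text \<open>The sum is the expansion of the product of \<open>- 1 + 1\<close> over \<open>M\<close>,
  which is 0 unless the product is empty.\<close>

lemma sum_alternating_Pow:
  assumes "finite M"
  shows "(\<Sum>S\<in>Pow M. (- 1 :: int) ^ card S) = of_bool (M = {})"
proof (cases "M = {}")
  case False
  then have "(\<Prod>a\<in>M. - 1 + 1 :: int) = 0" using assms by (simp add: card_gt_0_iff)
  then show ?thesis using prod_add[OF assms, of "\<lambda>_. - 1 :: int" "\<lambda>_. 1"] False
    by (simp del: prod_constant add: prod_constant[of "- 1"])
qed simp

context trace_alphabet
begin

lemma indep_commute: "(a, b) \<in> I \<Longrightarrow> (b, a) \<in> I"
  using indep_sym by (rule symD)

text \<open>Both letters of a commuting pair are first letters in either order. For a concatenation,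
  \<open>first_letters_append\<close> uses the left factor only through its first letters and its
  letter set, and congruent words share both.\<close>

lemma first_letters_cong:
  "(u, v) \<in> trace_cong A I \<Longrightarrow> first_letters I u = first_letters I v"
proof (induction rule: trace_cong.induct)
  case (tc_append u u' v v')
  then show ?case using trace_cong_set[OF tc_append.hyps(1)] by (simp add: first_letters_append)
qed (auto intro: indep_commute)

text \<open>The letters that survive from the tail are independent of the new head. Consequently
  every set of first letters spans a clique.\<close>

lemma first_letters_indep: "pairwise (\<lambda>a b. (a, b) \<in> I) (first_letters I u)"
proof (induction u)
  case (Cons b u)
  then have "pairwise (\<lambda>a b. (a, b) \<in> I) {a \<in> first_letters I u. (b, a) \<in> I}"
    by (rule pairwise_subset) blast
  then show ?case by (simp add: pairwise_insert indep_commute)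
qed simp

text \<open>By induction \<open>a\<close> moves to the front of the tail, and then it commutes past
  the head \<open>b\<close>.\<close>

lemma trace_cong_first_letter:
  "u \<in> lists A \<Longrightarrow> a \<in> first_letters I u \<Longrightarrow> (u, a # remove1 a u) \<in> trace_cong A I"
proof (induction u)
  case (Cons b u)
  show ?case
  proof (cases "a = b")
    case True
    then show ?thesis using Cons.prems trace_cong.tc_refl[of "b # u" A I] by simp
  next
    case False
    have b: "b \<in> A" and u: "u \<in> lists A" and a: "a \<in> first_letters I u" "(b, a) \<in> I"
      using Cons.prems False by auto
    have "a \<in> A" using a(2) indep_subset by auto
    moreover have "remove1 a u \<in> lists A" using u set_remove1_subset[of a u] by auto
    ultimately have "([b, a] @ remove1 a u, [a, b] @ remove1 a u) \<in> trace_cong A I"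
      using a b by (intro trace_cong.tc_append trace_cong.tc_comm trace_cong.tc_refl)
    with trace_cong_Cons[OF b Cons.IH[OF u a(1)]] False show ?thesis
      by (auto intro: trace_cong.tc_trans)
  qed
qed simp

lemma trace_cong_first_letters:
  assumes "u \<in> lists A" "distinct w" "set w \<subseteq> first_letters I u"
  shows "\<exists>v\<in>lists A. (u, w @ v) \<in> trace_cong A I"
  using assms
proof (induction w arbitrary: u)
  case Nil
  then show ?case using trace_cong.tc_refl[of u A I] by auto
next
  case (Cons a w)
  let ?r = "remove1 a u"
  have u: "(u, a # ?r) \<in> trace_cong A I" using Cons.prems by (intro trace_cong_first_letter) auto
  have r: "?r \<in> lists A" and a: "a \<in> A" using trace_cong_lists[OF u] by auto
  \<comment> \<open>The first letters of \<open>a # ?r\<close> are \<open>a\<close> and some first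
    letters of \<open>?r\<close>; since \<open>a # w\<close> is distinct, the letters of
    \<open>w\<close> are among the latter.\<close>
  have "set w \<subseteq> first_letters I ?r" using Cons.prems first_letters_cong[OF u] by auto
  then obtain v where v: "v \<in> lists A" "(?r, w @ v) \<in> trace_cong A I"
    using Cons.IH[OF r] Cons.prems(2) by auto
  then show ?case using trace_cong.tc_trans[OF u trace_cong_Cons[OF a v(2)]] by auto
qed

text \<open>All letters of \<open>u\<close> are first letters, so \<open>w\<close> can be pulled to
  the front of \<open>u\<close>; equal lengths leave nothing behind it. A clique is therefore
  determined by its letters.\<close>

lemma trace_cong_clique:
  assumes "u \<in> lists A" "distinct u" "pairwise (\<lambda>a b. (a, b) \<in> I) (set u)"
    and "distinct w" "set w = set u"
  shows "(u, w) \<in> trace_cong A I"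
proof -
  obtain v where v: "(u, w @ v) \<in> trace_cong A I"
    using trace_cong_first_letters[OF assms(1,4)] first_letters_clique[OF assms(2,3)] assms(5) by auto
  moreover have "length u = length w" using assms(2,4,5) by (metis distinct_card)
  ultimately show ?thesis using trace_cong_length[OF v] by simp
qed

text \<open>The same set as \<open>fact_pairs x\<close>, available without an action because the
  counting identity concerns the trace monoid alone.\<close>

abbreviation factorizations :: "'a list set \<Rightarrow> ('a list set \<times> 'a list set) set" where
  "factorizations x \<equiv> {(y, z). y \<in> carrier (trace_monoid A I) \<and> z \<in> carrier (trace_monoid A I) \<and>
     y \<otimes>\<^bsub>trace_monoid A I\<^esub> z = x}"

lemma clique_eqI:
  assumes "y \<in> cliques A I" "y' \<in> cliques A I" "letters y = letters y'"
  shows "y = y'"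
proof -
  obtain w where w: "w \<in> lists A" "distinct w" "pairwise (\<lambda>a b. (a, b) \<in> I) (set w)"
    "y = trace_of A I w" using assms(1) by (rule clique_obtain)
  obtain w' where w': "w' \<in> lists A" "distinct w'" "y' = trace_of A I w'"
    using assms(2) by (rule clique_obtain)
  have "(w, w') \<in> trace_cong A I"
    using assms(3) w w' by (intro trace_cong_clique) (simp_all add: letters_trace_of)
  then show ?thesis using w w' by (simp add: trace_of_eq_iff)
qed

lemma card_letters_clique:
  assumes "y \<in> cliques A I"
  shows "card (letters y) = trace_length y"
  using assms
  by (rule clique_obtain) (simp add: letters_trace_of trace_length_trace_of distinct_card)

lemma left_cancel:
  assumes "y \<in> carrier (trace_monoid A I)" "z \<in> carrier (trace_monoid A I)"
    "z' \<in> carrier (trace_monoid A I)"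
    "y \<otimes>\<^bsub>trace_monoid A I\<^esub> z = y \<otimes>\<^bsub>trace_monoid A I\<^esub> z'"
  shows "z = z'"
proof -
  obtain w v v' where *: "w \<in> lists A" "v \<in> lists A" "v' \<in> lists A"
      "y = trace_of A I w" "z = trace_of A I v" "z' = trace_of A I v'"
    using assms(1-3) unfolding in_carrier_iff by blast
  then have "(w @ v, w @ v') \<in> trace_cong A I"
    using assms(4) by (simp add: trace_mult flip: trace_of_eq_iff)
  then show ?thesis using * trace_cong_left_cancel by (simp add: trace_of_eq_iff)
qed

text \<open>The letters determine the clique, and the clique determines the cofactor by
  cancellation. Any set of first letters can be pulled to the front as a clique.\<close>

lemma bij_betw_clique_divisors:
  assumes u: "u \<in> lists A"
  shows "bij_betw (\<lambda>p. letters (fst p))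
    {p \<in> factorizations (trace_of A I u). fst p \<in> cliques A I} (Pow (first_letters I u))"
proof (rule bij_betw_imageI)
  let ?P = "{p \<in> factorizations (trace_of A I u). fst p \<in> cliques A I}"
  show "inj_on (\<lambda>p. letters (fst p)) ?P"
  proof (rule inj_onI)
    fix p q assume pq: "p \<in> ?P" "q \<in> ?P" "letters (fst p) = letters (fst q)"
    then have "fst p = fst q" by (intro clique_eqI) auto
    moreover from this have "snd p = snd q"
      using pq left_cancel[of "fst q" "snd p" "snd q"] by (simp add: split_beta)
    ultimately show "p = q" by (rule prod_eqI)
  qed
  show "(\<lambda>p. letters (fst p)) ` ?P = Pow (first_letters I u)"
  proof (intro equalityI subsetI)
    fix S assume "S \<in> (\<lambda>p. letters (fst p)) ` ?P"
    then obtain y z where yz: "y \<in> cliques A I" "z \<in> carrier (trace_monoid A I)"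
      "y \<otimes>\<^bsub>trace_monoid A I\<^esub> z = trace_of A I u" "S = letters y" by auto
    obtain w where w: "w \<in> lists A" "distinct w" "pairwise (\<lambda>a b. (a, b) \<in> I) (set w)"
      "y = trace_of A I w" using yz(1) by (rule clique_obtain)
    obtain v where v: "v \<in> lists A" "z = trace_of A I v" using yz(2) unfolding in_carrier_iff by blast
    have "(w @ v, u) \<in> trace_cong A I"
      using yz(3) u v w by (simp add: trace_mult flip: trace_of_eq_iff)
    \<comment> \<open>Every letter of the clique word \<open>w\<close> is a first letter of
      \<open>w\<close>, and it stays one when \<open>v\<close> is appended.\<close>
    from first_letters_cong[OF this] have "set w \<subseteq> first_letters I u"
      using first_letters_clique[OF w(2,3)] by (auto simp: first_letters_append)
    then show "S \<in> Pow (first_letters I u)" using yz(4) w by (simp add: letters_trace_of)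
  next
    fix S assume S: "S \<in> Pow (first_letters I u)"
    then have "finite S" using first_letters_subset[of I u] by (meson PowD finite_set finite_subset)
    then obtain w where w: "set w = S" "distinct w" using finite_distinct_list by auto
    obtain v where v: "v \<in> lists A" "(u, w @ v) \<in> trace_cong A I"
      using trace_cong_first_letters[OF u w(2)] S w(1) by auto
    have wA: "w \<in> lists A" using trace_cong_lists[OF v(2)] by auto
    have "pairwise (\<lambda>a b. (a, b) \<in> I) (set w)"
      using S w(1) by (auto intro: pairwise_subset[OF first_letters_indep])
    then have "trace_of A I w \<in> cliques A I" using wA w(2) by (auto simp: cliques_def)
    moreover have "trace_of A I w \<otimes>\<^bsub>trace_monoid A I\<^esub> trace_of A I v = trace_of A I u"
      using v u wA by (simp add: trace_mult trace_of_eq_iff trace_cong.tc_sym)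
    ultimately show "S \<in> (\<lambda>p. letters (fst p)) ` ?P"
      using wA v(1) w(1)
      by (intro image_eqI[of _ _ "(trace_of A I w, trace_of A I v)"])
        (auto simp: letters_trace_of in_carrier_iff)
  qed
qed

section \<open>The Cartier--Foata identity on both sides\<close>

lemma moebius_left:
  assumes "x \<in> carrier (trace_monoid A I)"
  shows "(\<Sum>(y, z)\<in>factorizations x. of_bool (y \<in> cliques A I) * (- 1 :: int) ^ trace_length y) =
    of_bool (x = \<one>\<^bsub>trace_monoid A I\<^esub>)"
proof -
  obtain u where u: "u \<in> lists A" "x = trace_of A I u" using assms unfolding in_carrier_iff by blast
  have "(\<Sum>(y, z)\<in>factorizations x. of_bool (y \<in> cliques A I) * (- 1 :: int) ^ trace_length y) =
      (\<Sum>p\<in>{p \<in> factorizations x. fst p \<in> cliques A I}. (- 1) ^ card (letters (fst p)))"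
    \<comment> \<open>Terms with a non-clique \<open>y\<close> are zero; the letters of a clique are
      distinct, so its sign depends only on their number.\<close>
    by (rule sum.mono_neutral_cong_right[OF finite_factorizations[OF finite_alphabet]])
      (auto simp: card_letters_clique)
  also have "\<dots> = (\<Sum>S\<in>Pow (first_letters I u). (- 1) ^ card S)"
    unfolding u(2) by (rule sum.reindex_bij_betw[OF bij_betw_clique_divisors[OF u(1)]])
  also have "\<dots> = of_bool (first_letters I u = {})"
    by (rule sum_alternating_Pow[OF finite_subset[OF first_letters_subset finite_set]])
  \<comment> \<open>The head of a non-empty word is always a first letter.\<close>
  also have "first_letters I u = {} \<longleftrightarrow> u = []" by (cases u) auto
  also have "u = [] \<longleftrightarrow> x = \<one>\<^bsub>trace_monoid A I\<^esub>"
    using trace_cong_length[of u "[]" A I] trace_cong.tc_refl[of "[]" A I] u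
    by (auto simp: trace_one trace_of_eq_iff)
  finally show ?thesis .
qed

lemma moebius_right:
  assumes x: "x \<in> carrier (trace_monoid A I)"
  shows "(\<Sum>(y, z)\<in>factorizations x. of_bool (z \<in> cliques A I) * (- 1 :: int) ^ trace_length z) =
    of_bool (x = \<one>\<^bsub>trace_monoid A I\<^esub>)"
proof -
  have rev_rev: "rev ` rev ` y = y" for y :: "'a list set" by (simp add: image_image)
  have cliques: "rev ` y \<in> cliques A I \<longleftrightarrow> y \<in> cliques A I" for y
    using rev_image_cliques[of y A I] rev_image_cliques[of "rev ` y" A I] by (auto simp: rev_rev)
  have one: "rev ` \<one>\<^bsub>trace_monoid A I\<^esub> = \<one>\<^bsub>trace_monoid A I\<^esub>"
    by (simp add: trace_one rev_image_trace_of)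
  have "(\<Sum>(y, z)\<in>factorizations x. of_bool (z \<in> cliques A I) * (- 1 :: int) ^ trace_length z) =
      (\<Sum>(y, z)\<in>factorizations (rev ` x). of_bool (y \<in> cliques A I) * (- 1) ^ trace_length y)"
    \<comment> \<open>Reverse both factors and swap them: the same formula gives the map and its
      inverse.\<close>
    by (rule sum.reindex_bij_witness[where i = "\<lambda>(y, z). (rev ` z, rev ` y)"
          and j = "\<lambda>(y, z). (rev ` z, rev ` y)"])
      (simp_all add: rev_rev cliques trace_length_rev_image split_beta rev_image_carrier
        flip: rev_image_mult)
  also have "\<dots> = of_bool (rev ` x = \<one>\<^bsub>trace_monoid A I\<^esub>)"
    by (rule moebius_left[OF rev_image_carrier[OF x]])
  also have "rev ` x = \<one>\<^bsub>trace_monoid A I\<^esub> \<longleftrightarrow> x = \<one>\<^bsub>trace_monoid A I\<^esub>"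
    using one rev_rev by metis
  finally show ?thesis .
qed

end

section \<open>Fibred series: summing over intermediate states\<close>

context partial_action
begin

text \<open>The intermediate state can only be the image of \<alpha> under \<open>y\<close>. It is
  not the sink, since the sink is absorbing and \<open>z\<close> leads on to \<gamma>.\<close>

lemma fibre_factorization:
  assumes "x \<in> fib \<alpha> \<gamma>" "(y, z) \<in> fact_pairs x"
  shows "\<exists>!\<beta>. \<beta> \<in> X0 \<and> y \<in> fib \<alpha> \<beta> \<and> z \<in> fib \<beta> \<gamma>"
proof -
  have yz: "y \<in> carrier (trace_monoid A I)" "z \<in> carrier (trace_monoid A I)"
    and \<alpha>: "\<alpha> \<in> X0" "\<gamma> \<in> X0"
    and act: "total_action E d (total_action E d (Some \<alpha>) y) z = Some \<gamma>"
    using assms total_action_mult[of "Some \<alpha>" y z] by (auto simp: fibre_def in_fact_pairs)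
  obtain u v where uv: "u \<in> lists A" "y = trace_of A I u" "v \<in> lists A" "z = trace_of A I v"
    using yz unfolding in_carrier_iff by blast
  let ?s = "total_action E d (Some \<alpha>) y"
  have s: "?s \<in> states"
    using \<alpha>(1) uv foldl_step_closed[of "Some \<alpha>" u] total_action_trace_of[of "Some \<alpha>" u] by auto
  have bot: "foldl (step E d) None v = None" for v
    by (induction v) (simp_all add: step_def)
  have "?s \<noteq> None"
  proof
    assume "?s = None"
    then show False using act uv total_action_trace_of[of None v] bot by simp
  qed
  then obtain \<beta> where "?s = Some \<beta>" "\<beta> \<in> X0" using s by auto
  then show ?thesis using act yz \<alpha> by (auto simp: fibre_def)
qed

text \<open>For a weight that does not involve the intermediate state, the sum over states only
  counts the admissible ones. There is exactly one if \<open>x\<close> lies in the fibre, and none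
  otherwise because fibres multiply.\<close>

lemma sum_over_fibres:
  assumes "finite X0"
  shows "(\<Sum>\<beta>\<in>X0. \<Sum>(y, z)\<in>fact_pairs x. of_bool (y \<in> fib \<alpha> \<beta> \<and> z \<in> fib \<beta> \<gamma>) * (f y z :: int)) =
    of_bool (x \<in> fib \<alpha> \<gamma>) * (\<Sum>(y, z)\<in>fact_pairs x. f y z)"
proof -
  have *: "(\<Sum>\<beta>\<in>X0. of_bool (y \<in> fib \<alpha> \<beta> \<and> z \<in> fib \<beta> \<gamma>)) = (of_bool (x \<in> fib \<alpha> \<gamma>) :: int)"
    if yz: "(y, z) \<in> fact_pairs x" for y z
  proof (cases "x \<in> fib \<alpha> \<gamma>")
    case True
    obtain \<beta> where "\<beta> \<in> X0" "\<And>\<beta>'. \<beta>' \<in> X0 \<Longrightarrow> (y \<in> fib \<alpha> \<beta>' \<and> z \<in> fib \<beta>' \<gamma>) \<longleftrightarrow> \<beta>' = \<beta>"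
      using fibre_factorization[OF True yz] by metis
    then have "(\<Sum>\<beta>\<in>X0. of_bool (y \<in> fib \<alpha> \<beta> \<and> z \<in> fib \<beta> \<gamma>)) =
        (\<Sum>\<beta>'\<in>X0. if \<beta>' = \<beta> then 1 else 0 :: int)"
      by (intro sum.cong) auto
    then show ?thesis using assms \<open>\<beta> \<in> X0\<close> True by simp
  next
    case False
    have "(of_bool (y \<in> fib \<alpha> \<beta> \<and> z \<in> fib \<beta> \<gamma>) :: int) = 0" for \<beta>
      using False yz fibre_mult[of y \<alpha> \<beta> z \<gamma>] by (auto simp: in_fact_pairs)
    then show ?thesis using False by (simp only: sum.neutral_const of_bool_eq)
  qed
  have "(\<Sum>\<beta>\<in>X0. \<Sum>(y, z)\<in>fact_pairs x. of_bool (y \<in> fib \<alpha> \<beta> \<and> z \<in> fib \<beta> \<gamma>) * f y z) =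
      (\<Sum>(y, z)\<in>fact_pairs x. (\<Sum>\<beta>\<in>X0. of_bool (y \<in> fib \<alpha> \<beta> \<and> z \<in> fib \<beta> \<gamma>)) * f y z)"
    unfolding case_prod_beta sum_distrib_right by (rule sum.swap)
  also have "\<dots> = (\<Sum>(y, z)\<in>fact_pairs x. of_bool (x \<in> fib \<alpha> \<gamma>) * f y z)"
    using * by (intro sum.cong) auto
  finally show ?thesis by (simp add: case_prod_beta sum_distrib_left)
qed

lemma zeta_carrier: "zeta A I X0 E d \<in> carrier alg"
  by (simp add: in_alg zeta_def)

lemma moebius_carrier: "moebius A I X0 E d \<in> carrier alg"
  by (simp add: in_alg moebius_def)

text \<open>This matches the right-hand side of \<open>sum_over_fibres\<close>: the unit fixes every
  state, so its membership in the fibre means that the two indices are the same state of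
  \<open>X0\<close>.\<close>

lemma one_alg_fibre:
  "\<one>\<^bsub>alg\<^esub> \<alpha> \<gamma> x = of_bool (x \<in> fib \<alpha> \<gamma>) * of_bool (x = \<one>\<^bsub>trace_monoid A I\<^esub>)"
  using monoid.one_closed[OF monoid_trace_monoid, of A I]
  by (auto simp: fibred_algebra_def fibre_def total_action_one)

text \<open>Once the fibre conditions are split off, the remaining weight depends only on
  \<open>y\<close>, so the sum over states collapses.\<close>

lemma moebius_zeta:
  assumes "finite X0"
  shows "moebius A I X0 E d \<otimes>\<^bsub>alg\<^esub> zeta A I X0 E d = \<one>\<^bsub>alg\<^esub>"
proof (intro ext)
  fix \<alpha> \<gamma> x
  have "(moebius A I X0 E d \<otimes>\<^bsub>alg\<^esub> zeta A I X0 E d) \<alpha> \<gamma> x =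
      (\<Sum>\<beta>\<in>X0. \<Sum>(y, z)\<in>fact_pairs x. of_bool (y \<in> fib \<alpha> \<beta> \<and> z \<in> fib \<beta> \<gamma>) *
        (of_bool (y \<in> cliques A I) * (- 1) ^ trace_length y))"
    unfolding mult_alg[OF moebius_carrier zeta_carrier]
    by (intro sum.cong refl) (auto simp: moebius_def zeta_def)
  also have "\<dots> = \<one>\<^bsub>alg\<^esub> \<alpha> \<gamma> x"
    \<comment> \<open>Outside the fibre both sides vanish; inside it \<open>x\<close> is a trace and
      the identity for left clique divisors applies.\<close>
    unfolding sum_over_fibres[OF assms] one_alg_fibre unfolding fact_pairs_def
    using moebius_left[of x] by (cases "x \<in> fib \<alpha> \<gamma>") (simp_all add: fibre_def)
  finally show "(moebius A I X0 E d \<otimes>\<^bsub>alg\<^esub> zeta A I X0 E d) \<alpha> \<gamma> x = \<one>\<^bsub>alg\<^esub> \<alpha> \<gamma> x" .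
qed

lemma zeta_moebius:
  assumes "finite X0"
  shows "zeta A I X0 E d \<otimes>\<^bsub>alg\<^esub> moebius A I X0 E d = \<one>\<^bsub>alg\<^esub>"
proof (intro ext)
  fix \<alpha> \<gamma> x
  have "(zeta A I X0 E d \<otimes>\<^bsub>alg\<^esub> moebius A I X0 E d) \<alpha> \<gamma> x =
      (\<Sum>\<beta>\<in>X0. \<Sum>(y, z)\<in>fact_pairs x. of_bool (y \<in> fib \<alpha> \<beta> \<and> z \<in> fib \<beta> \<gamma>) *
        (of_bool (z \<in> cliques A I) * (- 1) ^ trace_length z))"
    unfolding mult_alg[OF zeta_carrier moebius_carrier]
    by (intro sum.cong refl) (auto simp: moebius_def zeta_def)
  also have "\<dots> = \<one>\<^bsub>alg\<^esub> \<alpha> \<gamma> x"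
    unfolding sum_over_fibres[OF assms] one_alg_fibre unfolding fact_pairs_def
    using moebius_right[of x] by (cases "x \<in> fib \<alpha> \<gamma>") (simp_all add: fibre_def)
  finally show "(zeta A I X0 E d \<otimes>\<^bsub>alg\<^esub> moebius A I X0 E d) \<alpha> \<gamma> x = \<one>\<^bsub>alg\<^esub> \<alpha> \<gamma> x" .
qed

end

theorem theorem3:
  fixes A :: "'a set" and I :: "('a \<times> 'a) set"
    and X0 :: "'s set" and E :: "'s \<Rightarrow> 'a set" and d :: "'s \<Rightarrow> 'a \<Rightarrow> 's"
  assumes "partial_action A I X0 E d"
    and "finite X0"
  shows "let R = fibred_algebra A I X0 E d; \<mu> = moebius A I X0 E d; \<zeta> = zeta A I X0 E d in
    \<mu> \<in> carrier R \<and> \<zeta> \<in> carrier R \<and> \<mu> \<otimes>\<^bsub>R\<^esub> \<zeta> = \<one>\<^bsub>R\<^esub> \<and> \<zeta> \<otimes>\<^bsub>R\<^esub> \<mu> = \<one>\<^bsub>R\<^esub>"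
proof -
  interpret partial_action A I X0 E d by (rule assms(1))
  show ?thesis
    unfolding Let_def
    by (intro conjI moebius_carrier zeta_carrier moebius_zeta zeta_moebius assms(2))
qed

end
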